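(* Let $\varepsilon_n\searrow0$ and let $v_n$ be a sequence of solutions of $$-\varepsilon_n^2\Delta v_n=[v_n-1]_+^p\ \text{ in }\Omega,\qquad v_n\ge0\ \text{ in }\Omega,$$ such that, for some fixed $H_{p-1}>0$ and all $n$, $$\int_\Omega\frac1{\varepsilon_n^2}[v_n-1]_+^{p-1}\,dx\le H_{p-1}.$$ Then $[v_n-1]_+\to0$ locally uniformly in $\Omega$.
   Context: $\Omega\subset\mathbb R^2$ is a bounded domain of class $C^{2,\beta}$ for some $\beta\in(0,1)$, $p\in(1,+\infty)$, and $[t]_+=\max\{t,0\}$. Solutions are classical. *)

theory Defs
  imports "HOL-Analysis.Analysis"
begin

definition pos_part :: "real \<Rightarrow> real" ("[_]\<^sub>+") where
  "[t]\<^sub>+ = max t 0"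

definition partial_deriv :: "'n \<Rightarrow> (real ^ 'n \<Rightarrow> real) \<Rightarrow> real ^ 'n \<Rightarrow> real" where
  "partial_deriv i f x = frechet_derivative f (at x) (axis i 1)"

definition laplacian :: "(real ^ 'n \<Rightarrow> real) \<Rightarrow> real ^ 'n \<Rightarrow> real" where
  "laplacian f x = (\<Sum>i\<in>UNIV. partial_deriv i (partial_deriv i f) x)"

text \<open>The classes C1 and C2 on a set \<open>S\<close>, which is always meant to be open.\<close>

definition C1_on :: "(real ^ 'n \<Rightarrow> real) \<Rightarrow> (real ^ 'n) set \<Rightarrow> bool" where
  "C1_on f S \<longleftrightarrow>
    (\<forall>x\<in>S. f differentiable (at x)) \<and> (\<forall>i. continuous_on S (partial_deriv i f))"

definition C2_on :: "(real ^ 'n \<Rightarrow> real) \<Rightarrow> (real ^ 'n) set \<Rightarrow> bool" where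
  "C2_on f S \<longleftrightarrow> C1_on f S \<and> (\<forall>i. C1_on (partial_deriv i f) S)"

text \<open>Twice differentiable functions of one variable with \<open>\<beta>\<close>-Hoelder second derivative
  (for \<open>\<beta> > 0\<close> this makes the second derivative continuous).\<close>

definition C2_holder :: "real \<Rightarrow> (real \<Rightarrow> real) \<Rightarrow> bool" where
  "C2_holder \<beta> g \<longleftrightarrow>
    (\<forall>t. g differentiable (at t)) \<and> (\<forall>t. deriv g differentiable (at t)) \<and>
    (\<exists>C. \<forall>s t. \<bar>deriv (deriv g) s - deriv (deriv g) t\<bar> \<le> C * \<bar>s - t\<bar> powr \<beta>)"

text \<open>A bounded domain in the plane of class \<open>C\<^sup>2\<^sup>,\<^sup>\<beta>\<close>: near each boundary point, after an
  orthogonal change of coordinates, it is the region strictly above the graph of such a function.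
  Translations need not be allowed in \<open>T\<close>, as they can be absorbed in \<open>g\<close>. Asking \<open>g\<close> to be
  defined and \<open>C\<^sup>2\<^sup>,\<^sup>\<beta>\<close> on the whole line is no restriction: a local graph function extends,
  after shrinking \<open>r\<close>.\<close>

definition bounded_C2_holder_domain :: "real \<Rightarrow> (real ^ 2) set \<Rightarrow> bool" where
  "bounded_C2_holder_domain \<beta> \<Omega> \<longleftrightarrow>
    open \<Omega> \<and> connected \<Omega> \<and> \<Omega> \<noteq> {} \<and> bounded \<Omega> \<and>
    (\<forall>x0\<in>frontier \<Omega>. \<exists>r>0. \<exists>(T :: real ^ 2 \<Rightarrow> real ^ 2) g. orthogonal_transformation T \<and> C2_holder \<beta> g \<and>
      \<Omega> \<inter> ball x0 r = {x \<in> ball x0 r. g (T x $ 1) < T x $ 2})"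

text \<open>Classical solutions of \<open>- \<epsilon>\<^sup>2 \<Delta> v = [v - 1]\<^sub>+\<^sup>p\<close> in \<open>\<Omega>\<close>; no boundary condition is imposed.\<close>

definition classical_solution :: "real \<Rightarrow> real \<Rightarrow> (real ^ 2) set \<Rightarrow> (real ^ 2 \<Rightarrow> real) \<Rightarrow> bool" where
  "classical_solution p \<epsilon> \<Omega> v \<longleftrightarrow>
    C2_on v \<Omega> \<and> (\<forall>x\<in>\<Omega>. - (\<epsilon>\<^sup>2) * laplacian v x = [v x - 1]\<^sub>+ powr p)"

end

theory Submission imports Defs begin

text \<open>
  Let \<open>w = v\<^sub>n\<close>, \<open>u = [w - 1]\<^sub>+\<close> and \<open>\<epsilon> = \<epsilon>\<^sub>n\<close>. The integral bound yields, in every disc of radius \<open>\<epsilon>\<close>, a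
  point \<open>z\<close> at which \<open>w\<close> is bounded independently of \<open>n\<close>. Since \<open>w \<ge> 0\<close> is superharmonic on a disc
  of fixed radius \<open>\<rho>\<close> around \<open>z\<close>, its weighted means over discs of radius \<open>t\<close> decrease at rate at
  least \<open>c F / t\<close> for \<open>t \<ge> 4 \<epsilon>\<close>, where \<open>F\<close> is the integral of \<open>u\<^sup>p / \<epsilon>\<^sup>2\<close> over the disc of radius
  \<open>2 \<epsilon>\<close>, and they stay between \<open>0\<close> and a multiple of \<open>w z\<close>. Hence \<open>F\<close> is at most of order
  \<open>1 / ln (\<rho> / \<epsilon>)\<close>, a quantitative form of Liouville's theorem for the plane. Finally the potential
  \<open>u\<^bsup>p-1\<^esup>\<close> is small in a scale-subcritical norm, so the sub-mean value inequality at a maximum point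
  of \<open>(\<epsilon> - |y - x|)\<^sup>2 u(y)\<^sup>p\<close> turns the bound on the integral into a pointwise one.
\<close>

section \<open>Differentiation under the integral sign, and integrals of derivatives\<close>

text \<open>By the mean value inequality every difference quotient is dominated by \<open>B\<close>,
  so dominated convergence applies along each sequence that tends to \<open>t0\<close>.\<close>

lemma has_real_derivative_lebesgue_integral:
  fixes F F' :: "real \<Rightarrow> 'a \<Rightarrow> real"
  assumes "a < t0" "t0 < b"
    and int: "\<And>t. a < t \<Longrightarrow> t < b \<Longrightarrow> integrable M (F t)"
    and der: "\<And>t y. a < t \<Longrightarrow> t < b \<Longrightarrow> y \<in> space M \<Longrightarrow> ((\<lambda>t. F t y) has_real_derivative F' t y) (at t)"
    and bd: "\<And>t y. a < t \<Longrightarrow> t < b \<Longrightarrow> y \<in> space M \<Longrightarrow> \<bar>F' t y\<bar> \<le> B y"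
    and B: "integrable M B"
  shows "((\<lambda>t. \<integral>y. F t y \<partial>M) has_real_derivative (\<integral>y. F' t0 y \<partial>M)) (at t0)"
proof -
  let ?U = "{a<..<b}"
  have "((\<lambda>t. ((\<integral>y. F t y \<partial>M) - (\<integral>y. F t0 y \<partial>M)) / (t - t0)) \<longlongrightarrow> (\<integral>y. F' t0 y \<partial>M)) (at t0 within ?U)"
    unfolding tendsto_at_iff_sequentially comp_def
  proof (intro allI impI)
    fix X :: "nat \<Rightarrow> real" assume X: "\<forall>i. X i \<in> ?U - {t0}" "X \<longlonglongrightarrow> t0"
    have Xi: "a < X i" "X i < b" "X i \<noteq> t0" for i using X(1) by auto
    let ?q = "\<lambda>i y. (F (X i) y - F t0 y) / (X i - t0)"
    have lim: "(\<lambda>i. ?q i y) \<longlonglongrightarrow> F' t0 y" if "y \<in> space M" for y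
    proof -
      have "((\<lambda>t. (F t y - F t0 y) / (t - t0)) \<longlongrightarrow> F' t0 y) (at t0)"
        using der[OF assms(1,2) that] by (simp add: has_field_derivative_iff)
      then show ?thesis
        unfolding tendsto_at_iff_sequentially comp_def using X Xi by auto
    qed
    have bound: "\<bar>?q i y\<bar> \<le> B y" if y: "y \<in> space M" for i y
    proof -
      have "norm (F (X i) y - F t0 y) \<le> B y * norm (X i - t0)"
      proof (rule field_differentiable_bound[of ?U "\<lambda>t. F t y" "\<lambda>t. F' t y"])
        show "((\<lambda>t. F t y) has_real_derivative F' z y) (at z within ?U)" if "z \<in> ?U" for z
          using der[of z y] that y by (auto intro: has_field_derivative_at_within)
        show "norm (F' z y) \<le> B y" if "z \<in> ?U" for z using bd[of z y] that y by auto
      qed (use assms(1,2) Xi in auto)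
      then show ?thesis using Xi[of i] by (simp add: field_simps abs_mult)
    qed
    have m: "?q i \<in> borel_measurable M" for i
      using int[OF Xi(1,2)] int[OF assms(1,2)] by measurable
    \<comment> \<open>Measurability of the derivative is inherited from the quotients, as their
      pointwise limit.\<close>
    have m': "F' t0 \<in> borel_measurable M"
      by (rule borel_measurable_LIMSEQ_metric[of ?q]) (use m lim in auto)
    have "(\<lambda>i. \<integral>y. ?q i y \<partial>M) \<longlonglongrightarrow> (\<integral>y. F' t0 y \<partial>M)"
      by (rule integral_dominated_convergence[where w = B])
        (use m m' B lim bound in auto)
    moreover have "(\<lambda>i. \<integral>y. ?q i y \<partial>M) = (\<lambda>i. ((\<integral>y. F (X i) y \<partial>M) - (\<integral>y. F t0 y \<partial>M)) / (X i - t0))"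
      by (simp add: Bochner_Integration.integral_diff[OF int[OF Xi(1,2)] int[OF assms(1,2)]])
    ultimately show "(\<lambda>i. ((\<integral>y. F (X i) y \<partial>M) - (\<integral>y. F t0 y \<partial>M)) / (X i - t0)) \<longlonglongrightarrow> (\<integral>y. F' t0 y \<partial>M)"
      by simp
  qed
  then show ?thesis
    using assms(1,2) by (simp add: has_field_derivative_iff at_within_open[of t0 ?U])
qed

lemma integrable_continuous_compact_support:
  fixes q :: "'a::euclidean_space \<Rightarrow> real"
  assumes "compact K" "continuous_on K q" "\<And>y. y \<notin> K \<Longrightarrow> q y = 0"
  shows "integrable lborel q"
proof -
  have "(\<lambda>x. indicator K x *\<^sub>R q x) = q" using assms(3) by (intro ext) (auto simp: indicator_def)
  then show ?thesis using borel_integrable_compact[OF assms(1,2)] by simp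
qed

lemma lborel_integral_affine_scale:
  fixes f :: "'a::euclidean_space \<Rightarrow> real"
  assumes "c \<noteq> 0" and [measurable]: "f \<in> borel_measurable borel"
  shows "(\<integral>x. f x \<partial>lborel) = \<bar>c\<bar> ^ DIM('a) * (\<integral>x. f (t + c *\<^sub>R x) \<partial>lborel)"
proof -
  have "(\<integral>x. f x \<partial>lborel) = (\<integral>x. f x \<partial>density (distr lborel borel (\<lambda>x. t + c *\<^sub>R x)) (\<lambda>_. \<bar>c\<bar>^DIM('a)))"
    using lborel_affine[OF assms(1), of t] by simp
  also have "\<dots> = \<bar>c\<bar> ^ DIM('a) * (\<integral>x. f (t + c *\<^sub>R x) \<partial>lborel)"
    by (subst integral_density) (auto simp: integral_distr)
  finally show ?thesis .
qed

text \<open>By translation invariance the integral of \<open>G (y + t *\<^sub>R e)\<close> does not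
  depend on \<open>t\<close>. Its derivative at \<open>0\<close> is the integral in
  question.\<close>

lemma integral_directional_derivative_eq_0:
  fixes G :: "'a::euclidean_space \<Rightarrow> real"
  assumes K: "compact K" "\<And>y. y \<notin> K \<Longrightarrow> G y = 0"
    and der: "\<And>y. (G has_derivative G' y) (at y)"
    and bd: "\<And>y. \<bar>G' y e\<bar> \<le> B"
  shows "(\<integral>y. G' y e \<partial>lborel) = 0"
proof -
  have contG: "continuous_on UNIV G"
    using der has_derivative_continuous_on[of UNIV G G'] by simp
  \<comment> \<open>\<open>L\<close> contains the supports of all translates with \<open>t\<close>
    in \<open>[-1, 1]\<close>, which yields a single integrable dominating function.\<close>
  define L where "L = (\<lambda>z. fst z + snd z *\<^sub>R e) ` (K \<times> {-1..1::real})"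
  have "compact L" unfolding L_def
    by (intro compact_continuous_image compact_Times K compact_Icc continuous_intros)
  have zero: "G' z e = 0" if "z \<notin> K" for z
  proof -
    have "open (- K)" using K(1) compact_imp_closed open_Compl by blast
    have "(G has_derivative (\<lambda>_. 0)) (at z)"
    proof (rule has_derivative_transform_within_open[of "\<lambda>_. 0" "\<lambda>_. 0" z UNIV "-K"])
      show "0 = G y" if "y \<in> - K" for y using K(2) that by simp
    qed (use that \<open>open (- K)\<close> in simp_all)
    then have "G' z = (\<lambda>_. 0)" using der has_derivative_unique by blast
    then show ?thesis by simp
  qed
  have B0: "0 \<le> B" using bd[of 0] by linarith
  have dert: "((\<lambda>t. G (y + t *\<^sub>R e)) has_real_derivative G' (y + t *\<^sub>R e) e) (at t)" for t y
  proof -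
    have "((\<lambda>t. y + t *\<^sub>R e) has_derivative (\<lambda>h. h *\<^sub>R e)) (at t)"
      by (auto intro!: derivative_eq_intros)
    from has_derivative_compose[OF this der]
    have "((\<lambda>t. G (y + t *\<^sub>R e)) has_derivative (\<lambda>h. G' (y + t *\<^sub>R e) (h *\<^sub>R e))) (at t)" .
    moreover have "G' (y + t *\<^sub>R e) (h *\<^sub>R e) = G' (y + t *\<^sub>R e) e * h" for h
      using linear_cmul[OF has_derivative_linear[OF der]] by simp
    ultimately show ?thesis by (simp add: has_field_derivative_def)
  qed
  have intG: "integrable lborel (\<lambda>y. G (y + t *\<^sub>R e))" for t
  proof (rule integrable_continuous_compact_support)
    show "compact ((\<lambda>z. z - t *\<^sub>R e) ` K)"
      by (intro compact_continuous_image K continuous_intros)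
    show "G (y + t *\<^sub>R e) = 0" if "y \<notin> (\<lambda>z. z - t *\<^sub>R e) ` K" for y
      using that by (intro K(2)) (force simp: image_iff algebra_simps)
    show "continuous_on ((\<lambda>z. z - t *\<^sub>R e) ` K) (\<lambda>y. G (y + t *\<^sub>R e))"
      by (rule continuous_on_compose2[OF contG]) (auto intro!: continuous_intros)
  qed
  have "((\<lambda>t. \<integral>y. G (y + t *\<^sub>R e) \<partial>lborel) has_real_derivative (\<integral>y. G' (y + 0 *\<^sub>R e) e \<partial>lborel)) (at 0)"
  proof (rule has_real_derivative_lebesgue_integral[where a = "-1" and b = 1 and B = "\<lambda>y. B * indicator L y"])
    show "integrable lborel (\<lambda>y. B * indicator L y)"
      using integrable_continuous_compact_support[OF \<open>compact L\<close>, of "\<lambda>y. B * indicator L y"]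
      by (simp add: continuous_on_cong[of L L _ "\<lambda>_. B"])
    show "\<bar>G' (y + t *\<^sub>R e) e\<bar> \<le> B * indicator L y" if t: "-1 < t" "t < 1" for t y
    proof (cases "y \<in> L")
      case True then show ?thesis using bd by simp
    next
      case False
      have "y + t *\<^sub>R e \<notin> K"
      proof
        assume *: "y + t *\<^sub>R e \<in> K"
        have "y = (y + t *\<^sub>R e) + (-t) *\<^sub>R e" by simp
        then have "y \<in> L" unfolding L_def using * t
          by (intro image_eqI[of _ _ "(y + t *\<^sub>R e, -t)"]) auto
        then show False using False by simp
      qed
      then show ?thesis using zero B0 by simp
    qed
  qed (use intG dert in auto)
  moreover have "(\<integral>y. G (y + t *\<^sub>R e) \<partial>lborel) = (\<integral>y. G y \<partial>lborel)" for t
    using lborel_integral_affine_scale[of 1 G "t *\<^sub>R e"] contG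
    by (simp add: borel_measurable_continuous_onI add.commute)
  ultimately have "((\<lambda>t. \<integral>y. G y \<partial>lborel) has_real_derivative (\<integral>y. G' y e \<partial>lborel)) (at (0::real))"
    by simp
  then show ?thesis using DERIV_unique DERIV_const by blast
qed

section \<open>The quadratic bump and integration by parts against it\<close>

text \<open>The weights are \<open>4 * bump\<close> and \<open>bump\<^sup>2\<close>: the gradient of the latter is \<open>-4 * bump y * y\<close>, which
  lets the radial derivative of a mean be integrated by parts into a mean of the Laplacian.\<close>

definition bump :: "'a::euclidean_space \<Rightarrow> real" where
  "bump y = max 0 (1 - y \<bullet> y)"

lemma bump_nonneg: "0 \<le> bump y"
  by (simp add: bump_def)

lemma bump_le_1: "bump y \<le> 1"
  by (simp add: bump_def)

lemma bump_eq_0: "y \<notin> cball 0 1 \<Longrightarrow> bump y = 0"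
  using power_less_one_iff[of "norm y" 2] one_le_power[of "norm y" 2]
  by (auto simp: bump_def power2_norm_eq_inner[symmetric])

lemma continuous_on_bump [continuous_intros]: "continuous_on S (bump :: 'a::euclidean_space \<Rightarrow> real)"
  unfolding bump_def by (intro continuous_intros)

text \<open>Squaring removes the kink: at \<open>0\<close> the difference quotient is at most
  \<open>\<bar>h\<bar>\<close> in absolute value.\<close>

lemma has_real_derivative_max_0_square:
  "((\<lambda>s::real. (max 0 s)\<^sup>2) has_real_derivative 2 * max 0 s) (at s)"
proof -
  consider "s < 0" | "s = 0" | "0 < s" by linarith
  then show ?thesis
  proof cases
    case 1
    have "((\<lambda>_. 0) has_real_derivative 0) (at s)" by simp
    then have "((\<lambda>s::real. (max 0 s)\<^sup>2) has_real_derivative 0) (at s)"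
      by (rule has_field_derivative_transform_within_open[of _ _ _ "{..<0}"]) (use 1 in auto)
    then show ?thesis using 1 by simp
  next
    case 2
    have "((\<lambda>h::real. (max 0 h)\<^sup>2 / h) \<longlongrightarrow> 0) (at 0)"
    proof (rule Lim_null_comparison)
      show "\<forall>\<^sub>F h in at 0. norm ((max 0 h)\<^sup>2 / h) \<le> \<bar>h\<bar>"
        by (intro always_eventually allI) (auto simp: max_def power2_eq_square)
      show "((\<lambda>h::real. \<bar>h\<bar>) \<longlongrightarrow> 0) (at 0)"
        by (intro tendsto_rabs_zero tendsto_ident_at)
    qed
    then show ?thesis using 2 by (simp add: has_field_derivative_iff)
  next
    case 3
    have "((\<lambda>s. s\<^sup>2) has_real_derivative 2 * s) (at s)" by (auto intro!: derivative_eq_intros)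
    then have "((\<lambda>s::real. (max 0 s)\<^sup>2) has_real_derivative 2 * s) (at s)"
      by (rule has_field_derivative_transform_within_open[of _ _ _ "{0<..}"]) (use 3 in auto)
    then show ?thesis using 3 by simp
  qed
qed

lemma has_derivative_bump_square:
  "((\<lambda>y::'a::euclidean_space. (bump y)\<^sup>2) has_derivative (\<lambda>h. - 4 * bump y * (y \<bullet> h))) (at y)"
proof -
  have "((\<lambda>y::'a. 1 - y \<bullet> y) has_derivative (\<lambda>h. - 2 * (y \<bullet> h))) (at y)"
    by (auto intro!: derivative_eq_intros simp: inner_commute)
  from has_derivative_compose[OF this has_real_derivative_max_0_square[unfolded has_field_derivative_def]]
  show ?thesis unfolding bump_def by (simp add: algebra_simps)
qed

text \<open>The product \<open>(bump y)\<^sup>2 * h y\<close> has compact support, so its derivative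
  along \<open>e\<close> integrates to zero; the product rule splits that derivative into the two
  integrands.\<close>

lemma integral_by_parts_bump:
  fixes h :: "'a::euclidean_space \<Rightarrow> real"
  assumes S: "open S" "cball 0 1 \<subseteq> S"
    and der: "\<And>y. y \<in> S \<Longrightarrow> (h has_derivative h' y) (at y)"
    and cont: "continuous_on S (\<lambda>y. h' y e)"
  shows "(\<integral>y. 4 * bump y * (y \<bullet> e) * h y \<partial>lborel) = (\<integral>y. (bump y)\<^sup>2 * h' y e \<partial>lborel)"
proof -
  have conth: "continuous_on S h"
    using der S(1) by (meson continuous_at_imp_continuous_on has_derivative_continuous)
  \<comment> \<open>\<open>h\<close> is controlled on \<open>S\<close> only. Off the closed unit
    ball the product is locally zero, and the factors \<open>bump\<close> make \<open>G'\<close>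
    vanish there too.\<close>
  define G' where "G' y k = (bump y)\<^sup>2 * h' y k + - 4 * bump y * (y \<bullet> k) * h y" for y k
  have derG: "((\<lambda>y. (bump y)\<^sup>2 * h y) has_derivative G' y) (at y)" for y
  proof (cases "y \<in> cball 0 1")
    case True
    then have "y \<in> S" using S by auto
    from has_derivative_mult[OF has_derivative_bump_square der[OF this]]
    show ?thesis by (simp add: G'_def[abs_def])
  next
    case False
    then have "G' y = (\<lambda>_. 0)" using bump_eq_0[OF False] by (auto simp: G'_def)
    moreover have "((\<lambda>y. (bump y)\<^sup>2 * h y) has_derivative (\<lambda>_. 0)) (at y)"
      by (rule has_derivative_transform_within_open[of "\<lambda>_. 0" "\<lambda>_. 0" y UNIV "- cball 0 1"])
        (use False in \<open>auto simp: bump_eq_0\<close>)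
    ultimately show ?thesis by simp
  qed
  have c1: "continuous_on (cball 0 1) h" "continuous_on (cball 0 1) (\<lambda>y. h' y e)"
    using conth cont S(2) continuous_on_subset by blast+
  have cG: "continuous_on (cball 0 1) (\<lambda>y. G' y e)"
    unfolding G'_def by (intro continuous_intros c1)
  have bdd: "bounded ((\<lambda>y. G' y e) ` cball 0 1)"
    by (intro compact_imp_bounded compact_continuous_image cG) simp
  then obtain B where B: "\<And>y. y \<in> cball 0 1 \<Longrightarrow> \<bar>G' y e\<bar> \<le> B"
    unfolding bounded_iff ball_simps real_norm_def by blast
  have B0: "0 \<le> B" using B[of 0] by simp
  have "(\<integral>y. G' y e \<partial>lborel) = 0"
  proof (rule integral_directional_derivative_eq_0[OF compact_cball _ derG])
    show "(bump y)\<^sup>2 * h y = 0" if "y \<notin> cball 0 1" for y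
      using bump_eq_0[OF that] by simp
    show "\<bar>G' y e\<bar> \<le> B" for y
      using B[of y] B0 bump_eq_0[of y] by (cases "y \<in> cball 0 1") (auto simp: G'_def)
  qed
  moreover have "integrable lborel (\<lambda>y. (bump y)\<^sup>2 * h' y e)"
    by (rule integrable_continuous_compact_support[OF compact_cball[of 0 1]])
      (auto intro!: continuous_intros c1 simp: bump_eq_0)
  moreover have "integrable lborel (\<lambda>y. 4 * bump y * (y \<bullet> e) * h y)"
    by (rule integrable_continuous_compact_support[OF compact_cball[of 0 1]])
      (auto intro!: continuous_intros c1 simp: bump_eq_0)
  ultimately show ?thesis by (simp add: G'_def)
qed

section \<open>Weighted means and their radial derivative\<close>

lemma C1_on_has_derivative:
  fixes f :: "real ^ 'n \<Rightarrow> real"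
  assumes "C1_on f S" "x \<in> S"
  shows "(f has_derivative (\<lambda>h. \<Sum>i\<in>UNIV. h $ i * partial_deriv i f x)) (at x)"
proof -
  let ?D = "frechet_derivative f (at x)"
  have D: "(f has_derivative ?D) (at x)"
    using assms frechet_derivative_works unfolding C1_on_def by blast
  then have lin: "linear ?D" by (rule has_derivative_linear)
  have "?D h = (\<Sum>i\<in>UNIV. h $ i * partial_deriv i f x)" for h
  proof -
    have "?D h = ?D (\<Sum>i\<in>UNIV. h $ i *\<^sub>R axis i 1)"
      by (simp add: basis_expansion scalar_mult_eq_scaleR[symmetric])
    also have "\<dots> = (\<Sum>i\<in>UNIV. h $ i * partial_deriv i f x)"
      by (simp add: linear_sum[OF lin] linear_cmul[OF lin] partial_deriv_def)
    finally show ?thesis .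
  qed
  then show ?thesis using D by (metis (no_types, lifting) ext)
qed

lemma C1_on_continuous_on: "C1_on f S \<Longrightarrow> continuous_on S f"
  unfolding C1_on_def
  by (meson continuous_at_imp_continuous_on differentiable_imp_continuous_within)

lemma C2_on_continuous_on_laplacian: "C2_on f S \<Longrightarrow> continuous_on S (laplacian f)"
  unfolding laplacian_def[abs_def] C2_on_def C1_on_def by (intro continuous_on_sum) blast

text \<open>The mean is not normalised. Integrating over the fixed unit ball leaves \<open>t\<close>
  only in the argument of \<open>w\<close>, so differentiation in \<open>t\<close> does not touch
  the weight.\<close>

definition bump_mean :: "('a::euclidean_space \<Rightarrow> real) \<Rightarrow> 'a \<Rightarrow> real \<Rightarrow> real" where
  "bump_mean w x t = (\<integral>y. 4 * bump y * w (x + t *\<^sub>R y) \<partial>lborel)"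

lemma in_ball_affine:
  fixes x y :: "'a::real_normed_vector"
  assumes "y \<in> cball 0 1" "\<bar>t\<bar> < R"
  shows "x + t *\<^sub>R y \<in> ball x R"
  using assms mult_left_le[of "norm y" "\<bar>t\<bar>"] by (simp add: dist_norm)

lemma integrable_bump:
  fixes k :: "'a::euclidean_space \<Rightarrow> real"
  assumes "continuous_on (ball x R) k" "\<bar>t\<bar> < R" "0 < n"
  shows "integrable lborel (\<lambda>y. (bump y) ^ n * k (x + t *\<^sub>R y))"
proof (rule integrable_continuous_compact_support[OF compact_cball[of 0 1]])
  show "continuous_on (cball 0 1) (\<lambda>y. bump y ^ n * k (x + t *\<^sub>R y))"
    by (intro continuous_intros continuous_on_compose2[OF assms(1)])
      (use in_ball_affine assms(2) in blast)
qed (use assms(3) in \<open>simp add: bump_eq_0\<close>)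

text \<open>Differentiation pairs the gradient of \<open>w\<close> with the vector weight
  \<open>4 * bump y * y\<close>. This is minus the gradient of \<open>(bump y)\<^sup>2\<close>, so
  integration by parts turns the pairing into the Laplacian, and the inner scaling contributes the
  factor \<open>t\<close>.\<close>

lemma has_real_derivative_bump_mean:
  fixes w :: "real ^ 'n \<Rightarrow> real"
  assumes C2: "C2_on w S" and S: "open S" "ball x R \<subseteq> S" and t: "\<bar>t\<bar> < R"
  shows "(bump_mean w x has_real_derivative t * (\<integral>y. (bump y)\<^sup>2 * laplacian w (x + t *\<^sub>R y) \<partial>lborel)) (at t)"
proof -
  \<comment> \<open>An intermediate radius keeps all nearby \<open>s\<close> within one compact
    ball, on which the first derivatives are bounded.\<close>
  obtain R' where R': "\<bar>t\<bar> < R'" "R' < R" using dense t by blast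
  have C1: "C1_on w S" "C1_on (partial_deriv i w) S" for i
    using C2 by (auto simp: C2_on_def)
  have contp: "continuous_on S (partial_deriv i w)" "continuous_on S (partial_deriv j (partial_deriv i w))" for i j
    using C1 by (auto simp: C1_on_def)
  have sub: "cball x R' \<subseteq> S" using R' S(2) by auto
  have inS: "x + s *\<^sub>R y \<in> S" if "y \<in> cball 0 1" "\<bar>s\<bar> < R" for s y
    using in_ball_affine[OF that] S(2) by blast
  define D where "D = (\<lambda>s y. \<Sum>i\<in>UNIV. y $ i * partial_deriv i w (x + s *\<^sub>R y))"
  have "bounded ((\<lambda>z. \<Sum>i\<in>UNIV. \<bar>partial_deriv i w z\<bar>) ` cball x R')"
    by (intro compact_imp_bounded compact_continuous_image continuous_intros continuous_on_subset[OF contp(1) sub]) simp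
  then obtain M where M: "\<And>z. z \<in> cball x R' \<Longrightarrow> (\<Sum>i\<in>UNIV. \<bar>partial_deriv i w z\<bar>) \<le> M"
    unfolding bounded_iff ball_simps real_norm_def by (meson abs_le_D1)
  have int_bump: "integrable lborel (\<lambda>y::real^'n. 4 * bump y * M)"
    using integrable_bump[of "0::real^'n" 1 "\<lambda>_. 4 * M" 0 1] by (simp add: algebra_simps)
  have "((\<lambda>s. \<integral>y. 4 * bump y * w (x + s *\<^sub>R y) \<partial>lborel) has_real_derivative
      (\<integral>y. 4 * bump y * D t y \<partial>lborel)) (at t)"
  proof (rule has_real_derivative_lebesgue_integral[where a = "-R'" and b = R', OF _ _ _ _ _ int_bump])
    fix s assume "- R' < s" "s < R'"
    then have s: "\<bar>s\<bar> < R'" "\<bar>s\<bar> < R" using R' by auto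
    have "continuous_on (ball x R) w"
      using C1(1) C1_on_continuous_on S(2) continuous_on_subset by blast
    from integrable_mult_right[OF integrable_bump[OF this s(2), of 1], of 4]
    show "integrable lborel (\<lambda>y. 4 * bump y * w (x + s *\<^sub>R y))" by (simp add: mult.assoc)
    fix y :: "real ^ 'n"
    show "((\<lambda>s. 4 * bump y * w (x + s *\<^sub>R y)) has_real_derivative 4 * bump y * D s y) (at s)"
    proof (cases "y \<in> cball 0 1")
      case True
      have "((\<lambda>s. x + s *\<^sub>R y) has_derivative (\<lambda>h. h *\<^sub>R y)) (at s)"
        by (auto intro!: derivative_eq_intros)
      from has_derivative_compose[OF this C1_on_has_derivative[OF C1(1) inS[OF True s(2)]]]
      have "((\<lambda>s. w (x + s *\<^sub>R y)) has_derivative (\<lambda>h. h * D s y)) (at s)"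
        by (simp add: D_def sum_distrib_left mult.assoc)
      then have "((\<lambda>s. w (x + s *\<^sub>R y)) has_real_derivative D s y) (at s)"
        by (simp add: has_field_derivative_def mult.commute[of _ "D s y"])
      then show ?thesis by (rule DERIV_cmult)
    next
      case False
      then show ?thesis by (simp add: bump_eq_0)
    qed
    show "\<bar>4 * bump y * D s y\<bar> \<le> 4 * bump y * M"
    proof (cases "y \<in> cball 0 1")
      case True
      have "\<bar>D s y\<bar> \<le> (\<Sum>i\<in>UNIV. \<bar>y $ i * partial_deriv i w (x + s *\<^sub>R y)\<bar>)"
        unfolding D_def by (rule sum_abs)
      also have "\<dots> \<le> (\<Sum>i\<in>UNIV. \<bar>partial_deriv i w (x + s *\<^sub>R y)\<bar>)"
      proof (rule sum_mono)
        fix i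
        have "\<bar>y $ i\<bar> \<le> 1" using component_le_norm_cart[of y i] True by simp
        then show "\<bar>y $ i * partial_deriv i w (x + s *\<^sub>R y)\<bar> \<le> \<bar>partial_deriv i w (x + s *\<^sub>R y)\<bar>"
          by (simp add: abs_mult mult_left_le_one_le)
      qed
      also have "\<dots> \<le> M" using in_ball_affine[OF True s(1), of x] by (intro M) auto
      finally show ?thesis
        using bump_nonneg[of y] by (simp add: abs_mult mult_left_mono)
    qed (simp add: bump_eq_0)
  qed (use R' in auto)
  \<comment> \<open>From here the pairing is split into coordinates, each of which is integrated by
    parts separately.\<close>
  also have "(\<integral>y. 4 * bump y * D t y \<partial>lborel)
      = (\<integral>y. (\<Sum>i\<in>UNIV. 4 * bump y * (y \<bullet> axis i 1) * partial_deriv i w (x + t *\<^sub>R y)) \<partial>lborel)"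
    by (simp add: D_def sum_distrib_left inner_axis mult.assoc)
  also have "\<dots> = (\<Sum>i\<in>UNIV. \<integral>y. 4 * bump y * (y \<bullet> axis i 1) * partial_deriv i w (x + t *\<^sub>R y) \<partial>lborel)"
  proof (rule Bochner_Integration.integral_sum, rule integrable_continuous_compact_support[OF compact_cball[of 0 1]])
    show "continuous_on (cball 0 1) (\<lambda>y. 4 * bump y * (y \<bullet> axis i 1) * partial_deriv i w (x + t *\<^sub>R y))" for i
      by (intro continuous_intros continuous_on_compose2[OF contp(1)]) (use inS t in blast)
  qed (simp add: bump_eq_0)
  also have "\<dots> = (\<Sum>i\<in>UNIV. \<integral>y. (bump y)\<^sup>2 * (t * partial_deriv i (partial_deriv i w) (x + t *\<^sub>R y)) \<partial>lborel)"
  proof (rule sum.cong[OF refl])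
    fix i
    let ?h' = "\<lambda>y k. \<Sum>j\<in>UNIV. (t *\<^sub>R k) $ j * partial_deriv j (partial_deriv i w) (x + t *\<^sub>R y)"
    let ?S = "(\<lambda>y. x + t *\<^sub>R y) -` S"
    have h'i: "?h' y (axis i 1) = t * partial_deriv i (partial_deriv i w) (x + t *\<^sub>R y)" for y
      by (simp add: axis_def if_distrib[where f="\<lambda>a. t * a"] if_distrib[where f="\<lambda>a. a * _"] cong: if_cong)
    have "(\<integral>y. 4 * bump y * (y \<bullet> axis i 1) * partial_deriv i w (x + t *\<^sub>R y) \<partial>lborel)
        = (\<integral>y. (bump y)\<^sup>2 * ?h' y (axis i 1) \<partial>lborel)"
    proof (rule integral_by_parts_bump)
      show "open ?S" by (intro open_vimage S continuous_intros)
      show "cball 0 1 \<subseteq> ?S" using inS t by blast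
      show "((\<lambda>y. partial_deriv i w (x + t *\<^sub>R y)) has_derivative ?h' y) (at y)" if "y \<in> ?S" for y
      proof (rule has_derivative_compose[where f' = "\<lambda>k. t *\<^sub>R k"])
        show "((\<lambda>y. x + t *\<^sub>R y) has_derivative (\<lambda>k. t *\<^sub>R k)) (at y)"
          by (auto intro!: derivative_eq_intros)
        show "(partial_deriv i w has_derivative
            (\<lambda>h. \<Sum>j\<in>UNIV. h $ j * partial_deriv j (partial_deriv i w) (x + t *\<^sub>R y))) (at (x + t *\<^sub>R y))"
          using that C1_on_has_derivative[OF C1(2)] by simp
      qed
      show "continuous_on ?S (\<lambda>y. ?h' y (axis i 1))" unfolding h'i
        by (intro continuous_intros continuous_on_compose2[OF contp(2)]) auto
    qed
    then show "(\<integral>y. 4 * bump y * (y \<bullet> axis i 1) * partial_deriv i w (x + t *\<^sub>R y) \<partial>lborel)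
        = (\<integral>y. (bump y)\<^sup>2 * (t * partial_deriv i (partial_deriv i w) (x + t *\<^sub>R y)) \<partial>lborel)"
      unfolding h'i .
  qed
  also have "\<dots> = (\<integral>y. (\<Sum>i\<in>UNIV. (bump y)\<^sup>2 * (t * partial_deriv i (partial_deriv i w) (x + t *\<^sub>R y))) \<partial>lborel)"
  proof (rule Bochner_Integration.integral_sum[symmetric], rule integrable_continuous_compact_support[OF compact_cball[of 0 1]])
    show "continuous_on (cball 0 1) (\<lambda>y. (bump y)\<^sup>2 * (t * partial_deriv i (partial_deriv i w) (x + t *\<^sub>R y)))" for i
      by (intro continuous_intros continuous_on_compose2[OF contp(2)]) (use inS t in blast)
  qed (simp add: bump_eq_0)
  also have "\<dots> = (\<integral>y. t * ((bump y)\<^sup>2 * laplacian w (x + t *\<^sub>R y)) \<partial>lborel)"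
    by (simp add: laplacian_def sum_distrib_left algebra_simps)
  also have "\<dots> = t * (\<integral>y. (bump y)\<^sup>2 * laplacian w (x + t *\<^sub>R y) \<partial>lborel)"
    by simp
  finally show ?thesis unfolding bump_mean_def[abs_def] .
qed

section \<open>Mean value inequalities for the weighted means\<close>

text \<open>The space alone fixes this number, hence the \<open>itself\<close> argument. In the
  plane it equals \<open>2 * pi\<close>.\<close>

definition bump_mass :: "'a::euclidean_space itself \<Rightarrow> real" where
  "bump_mass (_ :: 'a itself) = (\<integral>y. 4 * bump (y :: 'a) \<partial>lborel)"

lemma integrable_bump_const:
  "0 < n \<Longrightarrow> integrable lborel (\<lambda>y::'a::euclidean_space. bump y ^ n)"
  using integrable_bump[of "0::'a" 1 "\<lambda>_. 1" 0 n] by simp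

lemma bump_mass_pos: "0 < bump_mass TYPE('a::euclidean_space)"
proof -
  \<comment> \<open>On this ball the weight is at least \<open>4 * (1 - 1/4) = 3\<close>.\<close>
  have "0 < 3 * measure lborel (ball (0::'a) (1/2))" by simp
  also have "\<dots> = (\<integral>y. 3 * indicator (ball (0::'a) (1/2)) y \<partial>lborel)" by simp
  also have "\<dots> \<le> bump_mass TYPE('a)"
    unfolding bump_mass_def
  proof (rule integral_mono')
    show "integrable lborel (\<lambda>y::'a. 4 * bump y)"
      using integrable_bump_const[of 1] by simp
    show "3 * indicator (ball 0 (1/2)) y \<le> 4 * bump y" for y :: 'a
    proof (cases "y \<in> ball 0 (1/2)")
      case True
      then have "y \<bullet> y \<le> (1/2)\<^sup>2"
        unfolding power2_norm_eq_inner[symmetric] by (intro power_mono) auto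
      then show ?thesis using True by (simp add: bump_def power2_eq_square)
    qed (simp add: bump_nonneg)
  qed (simp add: bump_nonneg)
  finally show ?thesis .
qed

lemma bump_mean_0: "bump_mean w x 0 = bump_mass TYPE('a) * w x" for x :: "'a::euclidean_space"
  by (simp add: bump_mean_def bump_mass_def)

text \<open>The derivative \<open>t * ?I t\<close> of the mean is at least
  \<open>- ?c * K * t / 4\<close>, since \<open>bump\<close> has integral \<open>?c / 4\<close>.
  Adding the primitive \<open>?c * K * t\<^sup>2 / 8\<close> makes the mean nondecreasing, and its
  values at \<open>0\<close> and \<open>r\<close> are compared.\<close>

lemma bump_sub_mean_value:
  fixes w :: "real ^ 'n \<Rightarrow> real"
  assumes C2: "C2_on w S" and S: "open S" "ball x R \<subseteq> S" and r: "0 < r" "r < R"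
    and lap: "\<And>z. z \<in> cball x r \<Longrightarrow> - K \<le> laplacian w z" and K: "0 \<le> K"
  shows "bump_mass TYPE(real^'n) * w x \<le> bump_mean w x r + bump_mass TYPE(real^'n) * K * r\<^sup>2 / 8"
proof -
  let ?c = "bump_mass TYPE(real^'n)"
  let ?I = "\<lambda>t. \<integral>y. (bump y)\<^sup>2 * laplacian w (x + t *\<^sub>R y) \<partial>lborel"
  let ?g = "\<lambda>t. bump_mean w x t + ?c * K * t\<^sup>2 / 8"
  have "?g 0 \<le> ?g r"
  proof (rule DERIV_nonneg_imp_nondecreasing[where f = ?g])
    fix t assume t: "0 \<le> t" "t \<le> r"
    have "(?g has_real_derivative t * ?I t + ?c * K * t / 4) (at t)"
      using has_real_derivative_bump_mean[OF C2 S, of t] t r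
      by (auto intro!: derivative_eq_intros)
    moreover have "- (?c / 4 * K) \<le> ?I t"
    proof -
      have "- (?c / 4 * K) = (\<integral>y. bump (y::real^'n) * (- K) \<partial>lborel)"
        by (simp add: bump_mass_def)
      also have "\<dots> \<le> ?I t"
      proof (rule integral_mono)
        show "integrable lborel (\<lambda>y::real^'n. bump y * (- K))"
          using integrable_bump_const[of 1, where 'a = "real^'n"] by simp
        show "integrable lborel (\<lambda>y. (bump y)\<^sup>2 * laplacian w (x + t *\<^sub>R y))"
          using integrable_bump[of x R "laplacian w" t 2] C2_on_continuous_on_laplacian[OF C2] S r t
            continuous_on_subset by auto
        show "bump y * (- K) \<le> (bump y)\<^sup>2 * laplacian w (x + t *\<^sub>R y)" for y :: "real ^ 'n"
        proof (cases "y \<in> cball 0 1")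
          case True
          have "norm (t *\<^sub>R y) \<le> r" using True t mult_mono[of "\<bar>t\<bar>" r "norm y" 1] by simp
          then have "- K \<le> laplacian w (x + t *\<^sub>R y)" by (intro lap) (simp add: dist_norm)
          then have "(bump y)\<^sup>2 * (- K) \<le> (bump y)\<^sup>2 * laplacian w (x + t *\<^sub>R y)"
            by (intro mult_left_mono) auto
          \<comment> \<open>As \<open>K\<close> is nonnegative and \<open>bump y\<close> at most
            \<open>1\<close>, the squared weight may be replaced by \<open>bump y\<close>, whose
            integral is known.\<close>
          moreover have "(bump y)\<^sup>2 * K \<le> bump y * K"
            using K bump_nonneg[of y] bump_le_1[of y]
            by (intro mult_right_mono) (auto simp: power2_eq_square mult_left_le)
          ultimately show ?thesis by simp
        qed (simp add: bump_eq_0)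
      qed
      finally show ?thesis .
    qed
    then have "0 \<le> t * (?I t + ?c / 4 * K)" using t by simp
    then have "0 \<le> t * ?I t + ?c * K * t / 4" by (simp add: algebra_simps)
    ultimately show "\<exists>y. (?g has_real_derivative y) (at t) \<and> 0 \<le> y" by blast
  qed (use r in simp)
  then show ?thesis by (simp add: bump_mean_0)
qed

text \<open>With \<open>F\<close> the integral on the left, the mean at radius
  \<open>t \<ge> T\<close> has derivative at most \<open>- 9/16 * F / t\<close>: the derivative
  formula gives a factor \<open>t\<close>, the scaling of area in the plane gives
  \<open>1 / t\<^sup>2\<close>. Integration from \<open>T\<close> to \<open>T'\<close> produces the
  logarithm, while the mean can drop by no more than its value at \<open>0\<close>, because it stays
  nonnegative.\<close>

lemma superharmonic_mass_log_bound:
  fixes w :: "real ^ 2 \<Rightarrow> real"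
  assumes C2: "C2_on w S" and S: "open S" "ball x R \<subseteq> S" and T: "0 < T" "T \<le> T'" "T' < R"
    and lap: "\<And>z. z \<in> ball x R \<Longrightarrow> laplacian w z \<le> 0"
    and nonneg: "\<And>z. z \<in> ball x R \<Longrightarrow> 0 \<le> w z"
  shows "9/16 * (\<integral>z. indicator (ball x (T/2)) z * (- laplacian w z) \<partial>lborel) * ln (T' / T)
    \<le> bump_mass TYPE(real^2) * w x"
proof -
  let ?I = "\<lambda>t. \<integral>y. (bump y)\<^sup>2 * laplacian w (x + t *\<^sub>R y) \<partial>lborel"
  define g where "g z = indicator (ball x (T/2)) z * (- laplacian w z)" for z
  define F where "F = (\<integral>z. g z \<partial>lborel)"
  have contL: "continuous_on (ball x R) (laplacian w)"
    using C2_on_continuous_on_laplacian[OF C2] S continuous_on_subset by blast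
  have g_meas: "g \<in> borel_measurable borel"
  proof -
    have "continuous_on (ball x (T/2)) (\<lambda>z. - laplacian w z)"
      using T by (intro continuous_intros continuous_on_subset[OF contL]) auto
    from borel_measurable_continuous_on_indicator[OF _ this] show ?thesis
      by (simp add: g_def[abs_def])
  qed
  have int: "integrable lborel (\<lambda>y. (bump y)\<^sup>2 * laplacian w (x + t *\<^sub>R y))" if "0 \<le> t" "t < R" for t
    using integrable_bump[OF contL, of t 2] that by simp
  have in_ball: "x + t *\<^sub>R y \<in> ball x R" if "0 \<le> t" "t < R" "y \<in> cball 0 1" for t y
    using in_ball_affine[of y t R x] that by simp
  have I_le: "?I t \<le> 0" if "0 \<le> t" "t < R" for t
  proof -
    have "(bump y)\<^sup>2 * laplacian w (x + t *\<^sub>R y) \<le> 0" for y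
      using lap[OF in_ball[OF that]] bump_eq_0[of y]
      by (cases "y \<in> cball 0 1") (auto simp: mult_nonneg_nonpos)
    then have "?I t \<le> (\<integral>y. 0 \<partial>(lborel :: (real^2) measure))" by (intro integral_mono int that) auto
    then show ?thesis by simp
  qed
  have F_le: "9/16 * F / t \<le> - (t * ?I t)" if t: "T \<le> t" "t < R" for t
  proof -
    have t0: "0 < t" using t T by simp
    have "F = t\<^sup>2 * (\<integral>y. g (x + t *\<^sub>R y) \<partial>lborel)"
      unfolding F_def using lborel_integral_affine_scale[OF _ g_meas, of t x] t0 by simp
    also have "(\<integral>y. g (x + t *\<^sub>R y) \<partial>lborel) \<le> (\<integral>y. - (16/9 * ((bump y)\<^sup>2 * laplacian w (x + t *\<^sub>R y))) \<partial>lborel)"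
    proof (rule integral_mono')
      show "integrable lborel (\<lambda>y. - (16/9 * ((bump y)\<^sup>2 * laplacian w (x + t *\<^sub>R y))))"
        using int[of t] t t0 by simp
      fix y :: "real ^ 2"
      show pos: "0 \<le> - (16/9 * ((bump y)\<^sup>2 * laplacian w (x + t *\<^sub>R y)))"
        using lap[OF in_ball[of t y]] bump_eq_0[of y] t t0
        by (cases "y \<in> cball 0 1") (auto simp: mult_nonneg_nonpos)
      show "g (x + t *\<^sub>R y) \<le> - (16/9 * ((bump y)\<^sup>2 * laplacian w (x + t *\<^sub>R y)))"
      proof (cases "x + t *\<^sub>R y \<in> ball x (T/2)")
        \<comment> \<open>For \<open>t \<ge> T\<close>, points of the disc of radius
          \<open>T / 2\<close> have \<open>norm y < 1/2\<close>, where \<open>bump\<close> is at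
          least \<open>3/4\<close>; its square is the constant \<open>9/16\<close>.\<close>
        case True
        then have "t * norm y < T / 2" using t0 by (simp add: dist_norm)
        also have "\<dots> \<le> t * (1/2)" using t by simp
        finally have ny: "norm y < 1/2" using t0 by simp
        then have "y \<bullet> y \<le> (1/2)\<^sup>2"
          unfolding power2_norm_eq_inner[symmetric] by (intro power_mono) auto
        then have "3/4 \<le> bump y" by (simp add: bump_def power2_eq_square)
        then have "(3/4)\<^sup>2 \<le> (bump y)\<^sup>2" by (intro power_mono) auto
        then have "1 \<le> 16/9 * (bump y)\<^sup>2" by (simp add: power2_eq_square)
        moreover have "0 \<le> - laplacian w (x + t *\<^sub>R y)"
          using lap[OF in_ball[of t y]] t t0 ny by simp
        ultimately have "1 * (- laplacian w (x + t *\<^sub>R y)) \<le> 16/9 * (bump y)\<^sup>2 * (- laplacian w (x + t *\<^sub>R y))"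
          by (rule mult_right_mono)
        then show ?thesis using True by (simp add: g_def)
      qed (use pos in \<open>simp add: g_def\<close>)
    qed
    also have "\<dots> = - (16/9 * ?I t)" by simp
    finally have "F \<le> t\<^sup>2 * (- (16/9 * ?I t))" using t0 by simp
    then show ?thesis using t0 by (simp add: field_simps power2_eq_square)
  qed
  let ?h = "\<lambda>t. bump_mean w x t + 9/16 * F * ln t"
  have der: "(bump_mean w x has_real_derivative t * ?I t) (at t)" if "0 \<le> t" "t < R" for t
    using has_real_derivative_bump_mean[OF C2 S] that by simp
  have "?h T' \<le> ?h T"
  proof (rule DERIV_nonpos_imp_nonincreasing[OF T(2)])
    fix t assume t: "T \<le> t" "t \<le> T'"
    have "(?h has_real_derivative t * ?I t + 9/16 * F / t) (at t)"
      using der[of t] t T by (auto intro!: derivative_eq_intros)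
    then show "\<exists>y. (?h has_real_derivative y) (at t) \<and> y \<le> 0"
      using F_le[of t] t T by force
  qed
  moreover have "bump_mean w x T \<le> bump_mean w x 0"
  proof (rule DERIV_nonpos_imp_nonincreasing[where f = "bump_mean w x"])
    fix t assume t: "0 \<le> t" "t \<le> T"
    then show "\<exists>y. (bump_mean w x has_real_derivative y) (at t) \<and> y \<le> 0"
      using der[of t] I_le[of t] T by (intro exI[of _ "t * ?I t"]) (auto simp: mult_nonneg_nonpos)
  qed (use T in simp)
  moreover have "0 \<le> bump_mean w x T'"
    unfolding bump_mean_def
  proof (rule Bochner_Integration.integral_nonneg)
    show "0 \<le> 4 * bump y * w (x + T' *\<^sub>R y)" for y
      using nonneg[OF in_ball[of T' y]] bump_eq_0[of y] bump_nonneg[of y] T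
      by (cases "y \<in> cball 0 1") auto
  qed
  ultimately have "9/16 * F * (ln T' - ln T) \<le> bump_mean w x 0" by (simp add: algebra_simps)
  then show ?thesis using T by (simp add: bump_mean_0 F_def g_def[abs_def] ln_div)
qed

section \<open>Positive parts, and a point at which the integrand is small\<close>

lemma pos_part_bounds: "0 \<le> [t]\<^sub>+" "t - 1 \<le> [t - 1]\<^sub>+"
  by (auto simp: pos_part_def)

lemma continuous_on_pos_part: "continuous_on S f \<Longrightarrow> continuous_on S (\<lambda>x. [f x]\<^sub>+)"
  unfolding pos_part_def by (intro continuous_intros)

text \<open>Otherwise the integral over the disc alone would be at least \<open>H * pi\<close>,
  which exceeds \<open>H\<close>. At radius \<open>\<epsilon>\<close> the area cancels the factor
  \<open>1 / \<epsilon>\<^sup>2\<close>.\<close>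

lemma exists_small_point:
  fixes g :: "real ^ 2 \<Rightarrow> real"
  assumes "0 < \<epsilon>" "0 < H" "ball x \<epsilon> \<subseteq> \<Omega>"
    and int: "(\<integral>\<^sup>+y\<in>\<Omega>. ennreal (1 / \<epsilon>\<^sup>2 * g y) \<partial>lborel) \<le> ennreal H"
  obtains y where "y \<in> ball x \<epsilon>" "g y \<le> H"
proof -
  have "\<exists>y\<in>ball x \<epsilon>. g y \<le> H"
  proof (rule ccontr)
    assume "\<not> ?thesis"
    then have big: "H < g y" if "y \<in> ball x \<epsilon>" for y using that by force
    have "ennreal (H * pi) = ennreal (H / \<epsilon>\<^sup>2) * emeasure lborel (ball x \<epsilon>)"
      using assms by (simp add: emeasure_ball unit_ball_vol_2 ennreal_mult[symmetric])
    also have "\<dots> = (\<integral>\<^sup>+y. ennreal (H / \<epsilon>\<^sup>2) * indicator (ball x \<epsilon>) y \<partial>lborel)"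
      by (simp add: nn_integral_cmult_indicator)
    also have "\<dots> \<le> (\<integral>\<^sup>+y\<in>\<Omega>. ennreal (1 / \<epsilon>\<^sup>2 * g y) \<partial>lborel)"
    proof (rule nn_integral_mono)
      fix y
      show "ennreal (H / \<epsilon>\<^sup>2) * indicator (ball x \<epsilon>) y \<le> ennreal (1 / \<epsilon>\<^sup>2 * g y) * indicator \<Omega> y"
        using big[of y] assms by (auto simp: indicator_def divide_right_mono intro!: ennreal_leI)
    qed
    also have "\<dots> \<le> ennreal H" by (rule int)
    finally have "H * pi \<le> H" using assms by (simp add: ennreal_le_iff)
    then show False using assms pi_gt3 by (simp add: mult_le_cancel_left1)
  qed
  then show thesis using that by blast
qed

text \<open>This replaces Hoelder's inequality in comparing the mean of \<open>[v - 1]\<^sub>+\<close> with that of its \<open>p\<close>-th power.\<close>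

lemma le_add_powr:
  fixes a s p :: real
  assumes "0 \<le> a" "0 < s" "1 < p"
  shows "a \<le> s + a powr p * s powr (1 - p)"
proof (cases "a \<le> s")
  case True
  then show ?thesis using powr_ge_zero[of a p] powr_ge_zero[of s "1 - p"] by (simp add: add_increasing2)
next
  case False
  then have "a powr (1 - p) \<le> s powr (1 - p)" using assms by (intro powr_mono2') auto
  then have "a powr p * a powr (1 - p) \<le> a powr p * s powr (1 - p)" by (intro mult_left_mono) auto
  then show ?thesis using False assms by (simp add: powr_add[symmetric])
qed

section \<open>Estimates for one solution\<close>

context
  fixes \<Omega> :: "(real ^ 2) set" and p \<epsilon> :: real and v :: "real ^ 2 \<Rightarrow> real"
  assumes \<Omega>: "open \<Omega>" and p: "1 < p" and \<epsilon>: "0 < \<epsilon>"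
    and sol: "classical_solution p \<epsilon> \<Omega> v" and v_nonneg: "\<And>x. x \<in> \<Omega> \<Longrightarrow> 0 \<le> v x"
begin

lemma C2_v: "C2_on v \<Omega>"
  using sol by (simp add: classical_solution_def)

lemma laplacian_v: "x \<in> \<Omega> \<Longrightarrow> laplacian v x = - ([v x - 1]\<^sub>+ powr p / \<epsilon>\<^sup>2)"
  using sol \<epsilon> unfolding classical_solution_def by (simp add: nonzero_eq_divide_eq minus_equation_iff field_simps)

lemma cont_v: "continuous_on \<Omega> v"
  using C2_v C1_on_continuous_on by (auto simp: C2_on_def)

lemma cont_powr: "continuous_on \<Omega> (\<lambda>x. [v x - 1]\<^sub>+ powr p)"
  using p by (intro continuous_on_powr' continuous_on_pos_part continuous_intros cont_v)
    (auto simp: pos_part_bounds)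

lemma integrable_powr:
  "cball x r \<subseteq> \<Omega> \<Longrightarrow> integrable lborel (\<lambda>y. indicator (cball x r) y * [v y - 1]\<^sub>+ powr p)"
  using borel_integrable_compact[OF compact_cball continuous_on_subset[OF cont_powr]] by simp

text \<open>Superharmonicity is used around a nearby point \<open>z\<close> of bounded height, since
  no bound on \<open>v x\<close> is available yet. The disc of radius \<open>2 * \<epsilon>\<close>
  around \<open>z\<close> covers the disc of radius \<open>\<epsilon>\<close> around
  \<open>x\<close>.\<close>

lemma powr_mass_bound:
  assumes "ball x \<rho> \<subseteq> \<Omega>" "8 * \<epsilon> \<le> \<rho>" "0 < H"
    and int: "(\<integral>\<^sup>+y\<in>\<Omega>. ennreal (1 / \<epsilon>\<^sup>2 * [v y - 1]\<^sub>+ powr (p - 1)) \<partial>lborel) \<le> ennreal H"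
  shows "(\<integral>y. indicator (cball x \<epsilon>) y * [v y - 1]\<^sub>+ powr p \<partial>lborel) * (9/16 * ln (\<rho> / (8 * \<epsilon>)))
    \<le> \<epsilon>\<^sup>2 * (bump_mass TYPE(real^2) * (1 + H powr (1 / (p - 1))))"
proof -
  let ?f = "\<lambda>y. [v y - 1]\<^sub>+ powr p"
  have "ball x \<epsilon> \<subseteq> \<Omega>" using assms(1,2) \<epsilon> by (auto intro: order_trans[OF subset_ball])
  from exists_small_point[OF \<epsilon> assms(3) this int] obtain z
    where z: "z \<in> ball x \<epsilon>" "[v z - 1]\<^sub>+ powr (p - 1) \<le> H" by blast
  \<comment> \<open>Since \<open>p > 1\<close>, the power \<open>p - 1\<close> can be inverted, and
    the height at \<open>z\<close> is bounded in terms of \<open>H\<close> and \<open>p\<close>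
    only.\<close>
  have "[v z - 1]\<^sub>+ = ([v z - 1]\<^sub>+ powr (p - 1)) powr (1 / (p - 1))"
    using p by (simp add: powr_powr pos_part_bounds)
  also have "\<dots> \<le> H powr (1 / (p - 1))"
    using z p by (intro powr_mono2) auto
  finally have vz: "v z \<le> 1 + H powr (1 / (p - 1))" using pos_part_bounds(2)[of "v z"] by linarith
  \<comment> \<open>Here \<open>dist x z < \<epsilon> \<le> \<rho> / 8\<close>, which leaves the
    radius \<open>7/8 * \<rho>\<close> around \<open>z\<close>.\<close>
  have sub: "ball z (7/8 * \<rho>) \<subseteq> \<Omega>"
  proof
    fix y assume y: "y \<in> ball z (7/8 * \<rho>)"
    have "dist x y \<le> dist x z + dist z y" by (rule dist_triangle)
    also have "\<dots> < \<epsilon> + 7/8 * \<rho>" using y z by simp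
    finally show "y \<in> \<Omega>" using assms(1,2) by auto
  qed
  have sub': "cball x \<epsilon> \<subseteq> ball z (2 * \<epsilon>)"
  proof
    fix y assume y: "y \<in> cball x \<epsilon>"
    have "dist z y \<le> dist z x + dist x y" by (rule dist_triangle)
    also have "\<dots> < \<epsilon> + \<epsilon>" using y z by (simp add: dist_commute)
    finally show "y \<in> ball z (2 * \<epsilon>)" by simp
  qed
  have sub'': "cball z (2 * \<epsilon>) \<subseteq> \<Omega>" using sub assms(2) \<epsilon> by (auto simp: subset_iff)
  \<comment> \<open>The radii are \<open>T = 4 * \<epsilon>\<close>, whose half is
    \<open>2 * \<epsilon>\<close>, and \<open>T' = \<rho> / 2\<close>, which is below
    \<open>7/8 * \<rho>\<close>. Their ratio is \<open>\<rho> / (8 * \<epsilon>)\<close>, at least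
    \<open>1\<close> by hypothesis.\<close>
  have "9/16 * (\<integral>y. indicator (ball z (4 * \<epsilon> / 2)) y * (- laplacian v y) \<partial>lborel) * ln ((\<rho> / 2) / (4 * \<epsilon>))
    \<le> bump_mass TYPE(real^2) * v z"
    by (rule superharmonic_mass_log_bound[OF C2_v \<Omega> sub])
      (use assms(2) \<epsilon> sub in \<open>auto simp: laplacian_v subset_iff intro!: v_nonneg\<close>)
  also have "\<dots> \<le> bump_mass TYPE(real^2) * (1 + H powr (1 / (p - 1)))"
    using vz bump_mass_pos[where 'a = "real^2"] by (intro mult_left_mono) auto
  finally have *: "9/16 * (\<integral>y. indicator (ball z (4 * \<epsilon> / 2)) y * (- laplacian v y) \<partial>lborel) * ln ((\<rho> / 2) / (4 * \<epsilon>))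
    \<le> bump_mass TYPE(real^2) * (1 + H powr (1 / (p - 1)))" .
  have "(\<integral>y. indicator (ball z (4 * \<epsilon> / 2)) y * (- laplacian v y) \<partial>lborel) =
    (\<integral>y. indicator (ball z (2 * \<epsilon>)) y * ?f y / \<epsilon>\<^sup>2 \<partial>lborel)"
    using sub'' by (intro Bochner_Integration.integral_cong)
      (auto simp: indicator_def laplacian_v subset_iff)
  then have eq: "(\<integral>y. indicator (ball z (4 * \<epsilon> / 2)) y * (- laplacian v y) \<partial>lborel) =
    (\<integral>y. indicator (ball z (2 * \<epsilon>)) y * ?f y \<partial>lborel) / \<epsilon>\<^sup>2" by simp
  have intb: "integrable lborel (\<lambda>y. indicator (ball z (2 * \<epsilon>)) y * ?f y)"
  proof -
    have "integrable lborel (\<lambda>y. indicator (ball z (2 * \<epsilon>)) y *\<^sub>R (indicator (cball z (2 * \<epsilon>)) y * ?f y))"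
      by (intro integrable_mult_indicator integrable_powr sub'') auto
    moreover have "(\<lambda>y. indicator (ball z (2 * \<epsilon>)) y *\<^sub>R (indicator (cball z (2 * \<epsilon>)) y * ?f y))
      = (\<lambda>y. indicator (ball z (2 * \<epsilon>)) y * ?f y)" by (auto simp: indicator_def)
    ultimately show ?thesis by simp
  qed
  have "(\<integral>y. indicator (cball x \<epsilon>) y * ?f y \<partial>lborel) \<le> (\<integral>y. indicator (ball z (2 * \<epsilon>)) y * ?f y \<partial>lborel)"
    by (rule integral_mono'[OF intb]) (use sub' in \<open>auto simp: indicator_def\<close>)
  moreover have "0 \<le> 9/16 * ln (\<rho> / (8 * \<epsilon>))" using assms(2) \<epsilon> by (simp add: ln_ge_zero)
  ultimately have "(\<integral>y. indicator (cball x \<epsilon>) y * ?f y \<partial>lborel) * (9/16 * ln (\<rho> / (8 * \<epsilon>)))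
    \<le> (\<integral>y. indicator (ball z (2 * \<epsilon>)) y * ?f y \<partial>lborel) * (9/16 * ln (\<rho> / (8 * \<epsilon>)))"
    by (rule mult_right_mono)
  also have "\<dots> \<le> \<epsilon>\<^sup>2 * (bump_mass TYPE(real^2) * (1 + H powr (1 / (p - 1))))"
    using * \<epsilon> unfolding eq by (simp add: field_simps)
  finally show ?thesis .
qed

text \<open>Put \<open>U = v x - 1\<close>. In the sub-mean value inequality at \<open>x\<close> the
  error from the Laplacian costs a quarter of \<open>?c * U\<close>, thanks to the restriction on
  \<open>r\<close>, and passing from the mean of \<open>v\<close> to that of the \<open>p\<close>-th
  power costs another quarter. Half of \<open>?c * U\<close> is left to be bounded by
  \<open>J\<close>.\<close>

lemma scale_invariant_bound:
  assumes sub: "ball x R \<subseteq> \<Omega>" and r: "0 < r" "r < R" and K: "0 < v x - 1"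
    and max: "\<And>z. z \<in> cball x r \<Longrightarrow> [v z - 1]\<^sub>+ powr p \<le> 4 * (v x - 1) powr p"
    and small: "(v x - 1) powr (p - 1) * r\<^sup>2 \<le> \<epsilon>\<^sup>2 / 2"
    and J: "(\<integral>y. indicator (cball x r) y * [v y - 1]\<^sub>+ powr p \<partial>lborel) \<le> J"
  shows "(v x - 1) powr p * r\<^sup>2 \<le> 2 * 4 powr p / bump_mass TYPE(real^2) * J"
proof -
  let ?c = "bump_mass TYPE(real^2)" and ?f = "\<lambda>y. [v y - 1]\<^sub>+ powr p"
  define U where "U = v x - 1"
  have U: "0 < U" using K by (simp add: U_def)
  have c: "0 < ?c" by (rule bump_mass_pos)
  have csub: "cball x r \<subseteq> \<Omega>" using sub r by auto
  have upper: "?c * v x \<le> bump_mean v x r + ?c * (4 * U powr p / \<epsilon>\<^sup>2) * r\<^sup>2 / 8"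
  proof (rule bump_sub_mean_value[OF C2_v \<Omega> sub r])
    show "- (4 * U powr p / \<epsilon>\<^sup>2) \<le> laplacian v z" if "z \<in> cball x r" for z
      using max[OF that] csub that \<epsilon> by (auto simp: laplacian_v U_def divide_right_mono)
  qed (use \<epsilon> in simp)
  have "U powr p * r\<^sup>2 / \<epsilon>\<^sup>2 \<le> U / 2"
  proof -
    have "U powr p = U * U powr (p - 1)" using U powr_add[of U 1 "p - 1"] by simp
    then have "U powr p * r\<^sup>2 = U * (U powr (p - 1) * r\<^sup>2)" by simp
    also have "\<dots> \<le> U * (\<epsilon>\<^sup>2 / 2)" using small U by (intro mult_left_mono) (auto simp: U_def)
    finally show ?thesis using \<epsilon> by (simp add: field_simps)
  qed
  then have "?c / 2 * (U powr p * r\<^sup>2 / \<epsilon>\<^sup>2) \<le> ?c / 2 * (U / 2)"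
    using c by (intro mult_left_mono) auto
  then have source: "?c * (4 * U powr p / \<epsilon>\<^sup>2) * r\<^sup>2 / 8 \<le> ?c * (U / 4)" by simp
  have mean: "bump_mean v x r \<le> ?c * (1 + U / 4) + 4 * (U / 4) powr (1 - p) * (J / r\<^sup>2)"
  proof -
    let ?g = "\<lambda>z. indicator (cball x r) z * ?f z"
    have intg: "integrable lborel (\<lambda>y. ?g (x + r *\<^sub>R y))"
    proof (rule integrable_continuous_compact_support[OF compact_cball[of 0 1]])
      have in_c: "x + r *\<^sub>R y \<in> cball x r" if "y \<in> cball 0 1" for y
        using that r by (simp add: dist_norm)
      have "continuous_on (cball 0 1) (\<lambda>y. ?f (x + r *\<^sub>R y))"
        by (rule continuous_on_compose2[OF cont_powr]) (use in_c csub in \<open>auto intro!: continuous_intros\<close>)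
      then show "continuous_on (cball 0 1) (\<lambda>y. ?g (x + r *\<^sub>R y))"
        by (rule continuous_on_eq) (use in_c in auto)
      show "?g (x + r *\<^sub>R y) = 0" if "y \<notin> cball 0 1" for y
        using that r by (simp add: dist_norm indicator_def)
    qed
    have int1: "integrable lborel (\<lambda>y::real^2. (1 + U / 4) * (4 * bump y))"
      using integrable_bump_const[of 1, where 'a = "real^2"] by simp
    have "bump_mean v x r \<le> (\<integral>y. (1 + U / 4) * (4 * bump y) + 4 * (U / 4) powr (1 - p) * ?g (x + r *\<^sub>R y) \<partial>lborel)"
      unfolding bump_mean_def
    proof (rule integral_mono')
      show "integrable lborel (\<lambda>y. (1 + U / 4) * (4 * bump y) + 4 * (U / 4) powr (1 - p) * ?g (x + r *\<^sub>R y))"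
        by (intro Bochner_Integration.integrable_add[OF int1] integrable_mult_right intg)
      fix y :: "real ^ 2"
      have g0: "0 \<le> 4 * (U / 4) powr (1 - p) * ?g (x + r *\<^sub>R y)" by simp
      show "0 \<le> (1 + U / 4) * (4 * bump y) + 4 * (U / 4) powr (1 - p) * ?g (x + r *\<^sub>R y)"
        using g0 bump_nonneg[of y] U by (intro add_nonneg_nonneg mult_nonneg_nonneg) auto
      show "4 * bump y * v (x + r *\<^sub>R y) \<le> (1 + U / 4) * (4 * bump y) + 4 * (U / 4) powr (1 - p) * ?g (x + r *\<^sub>R y)"
      proof (cases "y \<in> cball 0 1")
        case True
        \<comment> \<open>The threshold \<open>U / 4\<close> is small enough to be absorbed on the
          left later.\<close>
        let ?q = "U / 4" and ?z = "x + r *\<^sub>R y"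
        have z: "?z \<in> cball x r" using True r by (simp add: dist_norm)
        have "v ?z \<le> 1 + [v ?z - 1]\<^sub>+" using pos_part_bounds(2)[of "v ?z"] by linarith
        also have "\<dots> \<le> 1 + (?q + ?f ?z * ?q powr (1 - p))"
          using U p by (intro add_left_mono le_add_powr) (auto simp: pos_part_bounds)
        finally have "4 * bump y * v ?z \<le> 4 * bump y * (1 + (?q + ?f ?z * ?q powr (1 - p)))"
          using bump_nonneg[of y] by (intro mult_left_mono) auto
        also have "\<dots> = (1 + ?q) * (4 * bump y) + bump y * (4 * ?q powr (1 - p) * ?f ?z)"
          by (simp add: algebra_simps)
        also have "\<dots> \<le> (1 + ?q) * (4 * bump y) + 1 * (4 * ?q powr (1 - p) * ?f ?z)"
          using bump_le_1[of y] by (intro add_left_mono mult_right_mono) auto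
        finally show ?thesis using z by simp
      next
        case False
        then show ?thesis using g0 by (simp add: bump_eq_0)
      qed
    qed
    also have "\<dots> = (1 + U / 4) * ?c + 4 * (U / 4) powr (1 - p) * (\<integral>y. ?g (x + r *\<^sub>R y) \<partial>lborel)"
      by (subst Bochner_Integration.integral_add[OF int1 integrable_mult_right[OF intg]])
        (simp add: bump_mass_def)
    also have "(\<integral>y. ?g (x + r *\<^sub>R y) \<partial>lborel) = (\<integral>y. ?g y \<partial>lborel) / r\<^sup>2"
      using lborel_integral_affine_scale[of r ?g x] borel_measurable_integrable[OF integrable_powr[OF csub]] r
      by simp
    also have "(1 + U / 4) * ?c + 4 * (U / 4) powr (1 - p) * ((\<integral>y. ?g y \<partial>lborel) / r\<^sup>2)
      \<le> (1 + U / 4) * ?c + 4 * (U / 4) powr (1 - p) * (J / r\<^sup>2)"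
      using J by (intro add_left_mono mult_left_mono divide_right_mono) auto
    finally show ?thesis by (simp add: mult.commute)
  qed
  have "?c * v x = ?c + ?c * U" "?c * (1 + U / 4) = ?c + ?c * U / 4"
    by (simp_all add: U_def algebra_simps)
  \<comment> \<open>The constant \<open>?c\<close> cancels because \<open>v x = 1 + U\<close>, and
    two quarters of \<open>?c * U\<close> move to the left.\<close>
  with upper source mean have "?c * U / 2 \<le> 4 * (U / 4) powr (1 - p) * (J / r\<^sup>2)"
    by linarith
  also have "(U / 4) powr (1 - p) = U powr (1 - p) * 4 powr p / 4"
    using U by (simp add: powr_divide powr_diff)
  \<comment> \<open>The new factor cancels \<open>U powr (1 - p)\<close> and
    \<open>1 / r\<^sup>2\<close> on the right and completes \<open>U powr p * r\<^sup>2\<close> on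
    the left.\<close>
  finally have "?c * U / 2 * (U powr (p - 1) * r\<^sup>2) \<le> U powr (1 - p) * 4 powr p * (J / r\<^sup>2) * (U powr (p - 1) * r\<^sup>2)"
    by (intro mult_right_mono) auto
  also have "\<dots> = (U powr (1 - p) * U powr (p - 1)) * 4 powr p * J"
    using r by simp
  also have "U powr (1 - p) * U powr (p - 1) = 1" using U by (simp add: powr_add[symmetric])
  finally have "?c * (U * U powr (p - 1)) * r\<^sup>2 \<le> 2 * 4 powr p * J" by (simp add: algebra_simps)
  moreover have "U * U powr (p - 1) = U powr p" using U powr_add[of U 1 "p - 1"] by simp
  ultimately have "?c * (U powr p * r\<^sup>2) \<le> 2 * 4 powr p * J" by (simp add: mult.assoc)
  then show ?thesis unfolding U_def[symmetric] using c by (simp add: pos_le_divide_eq mult.commute)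
qed

text \<open>The comparison with factor \<open>4\<close> in \<open>scale_invariant_bound\<close> may
  fail at \<open>x\<close>, so the estimate is made at a maximum point \<open>x0\<close> of a
  weighted power and carried back by maximality. If half the distance from \<open>x0\<close> to the
  circle were not an admissible radius, the largest admissible one would force
  \<open>U \<le> 1\<close>, and then the half distance would be admissible after all.\<close>

lemma pointwise_bound:
  assumes sub: "ball x (2 * \<epsilon>) \<subseteq> \<Omega>"
    and J: "(\<integral>y. indicator (cball x \<epsilon>) y * [v y - 1]\<^sub>+ powr p \<partial>lborel) \<le> \<epsilon>\<^sup>2 * \<delta>"
    and \<delta>: "4 * 4 powr p / bump_mass TYPE(real^2) * \<delta> \<le> 1"
  shows "[v x - 1]\<^sub>+ powr p \<le> 8 * 4 powr p / bump_mass TYPE(real^2) * \<delta>"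
proof -
  define C where "C = 2 * 4 powr p / bump_mass TYPE(real^2)"
  let ?f = "\<lambda>y. [v y - 1]\<^sub>+ powr p"
  \<comment> \<open>The weight vanishes on the boundary circle, so a positive maximum lies inside;
    its square matches the \<open>r\<^sup>2\<close> of \<open>scale_invariant_bound\<close>.\<close>
  define \<Phi> where "\<Phi> y = (\<epsilon> - dist x y)\<^sup>2 * ?f y" for y
  have C: "0 < C" using bump_mass_pos[where 'a = "real^2"] by (simp add: C_def)
  have "0 \<le> (\<integral>y. indicator (cball x \<epsilon>) y * ?f y \<partial>lborel)"
    by (intro Bochner_Integration.integral_nonneg) simp
  then have "0 \<le> \<epsilon>\<^sup>2 * \<delta>" using J by linarith
  then have \<delta>0: "0 \<le> \<delta>" using \<epsilon> by (simp add: zero_le_mult_iff)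
  have csub: "cball x \<epsilon> \<subseteq> \<Omega>" using sub \<epsilon> by auto
  have "continuous_on (cball x \<epsilon>) \<Phi>"
    unfolding \<Phi>_def by (intro continuous_intros continuous_on_subset[OF cont_powr csub])
  moreover have "cball x \<epsilon> \<noteq> {}" using \<epsilon> by simp
  ultimately obtain x0 where x0: "x0 \<in> cball x \<epsilon>" "\<And>y. y \<in> cball x \<epsilon> \<Longrightarrow> \<Phi> y \<le> \<Phi> x0"
    using continuous_attains_sup[OF compact_cball] by blast
  have \<Phi>x: "\<epsilon>\<^sup>2 * ?f x \<le> \<Phi> x0" using x0(2)[of x] \<epsilon> by (simp add: \<Phi>_def)
  have "\<Phi> x0 \<le> 4 * C * (\<epsilon>\<^sup>2 * \<delta>)"
  proof (cases "dist x x0 < \<epsilon> \<and> 0 < v x0 - 1")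
    case False
    \<comment> \<open>On the circle the weight is zero; where \<open>v x0 \<le> 1\<close> the other
      factor is \<open>0 powr p\<close>, which is \<open>0\<close>.\<close>
    then have "\<Phi> x0 = 0" using x0(1) by (auto simp: \<Phi>_def pos_part_def)
    then show ?thesis using C \<delta>0 by simp
  next
    case True
    define d where "d = \<epsilon> - dist x x0"
    define U where "U = v x0 - 1"
    have d: "0 < d" "d \<le> \<epsilon>" and U: "0 < U" using True by (auto simp: d_def U_def)
    have \<Phi>0: "\<Phi> x0 = d\<^sup>2 * U powr p" using U by (simp add: \<Phi>_def d_def U_def pos_part_def)
    have sub0: "ball x0 \<epsilon> \<subseteq> \<Omega>"
    proof
      fix z assume z: "z \<in> ball x0 \<epsilon>"
      have "dist x z \<le> dist x x0 + dist x0 z" by (rule dist_triangle)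
      then show "z \<in> \<Omega>" using z x0(1) sub by auto
    qed
    \<comment> \<open>Within \<open>d / 2\<close> of \<open>x0\<close> the distance to the circle
      stays at least \<open>d / 2\<close>, so maximality loses a factor of at most four.\<close>
    have half: "?f z \<le> 4 * U powr p" if "z \<in> cball x0 (d / 2)" for z
    proof -
      have "dist x z \<le> dist x x0 + dist x0 z" by (rule dist_triangle)
      then have dz: "d / 2 \<le> \<epsilon> - dist x z" using that by (simp add: d_def field_simps)
      then have "z \<in> cball x \<epsilon>" using d by simp
      then have "(\<epsilon> - dist x z)\<^sup>2 * ?f z \<le> d\<^sup>2 * U powr p" using x0(2) \<Phi>0 by (metis \<Phi>_def)
      moreover have "(d / 2)\<^sup>2 * ?f z \<le> (\<epsilon> - dist x z)\<^sup>2 * ?f z"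
        using dz d by (intro mult_right_mono power_mono) auto
      ultimately have "d\<^sup>2 * ?f z \<le> d\<^sup>2 * (4 * U powr p)" by (simp add: power_divide)
      then show ?thesis using d by simp
    qed
    have bound: "U powr p * r\<^sup>2 \<le> C * (\<epsilon>\<^sup>2 * \<delta>)"
      if r: "0 < r" "r \<le> d / 2" "U powr (p - 1) * r\<^sup>2 \<le> \<epsilon>\<^sup>2 / 2" for r
      unfolding C_def U_def
    proof (rule scale_invariant_bound[OF sub0 r(1)])
      show "r < \<epsilon>" using r d by simp
      show "0 < v x0 - 1" using U by (simp add: U_def)
      show "?f z \<le> 4 * (v x0 - 1) powr p" if "z \<in> cball x0 r" for z
        using half[of z] that r by (simp add: U_def)
      show "(v x0 - 1) powr (p - 1) * r\<^sup>2 \<le> \<epsilon>\<^sup>2 / 2" using r by (simp add: U_def)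
      have "cball x0 r \<subseteq> cball x \<epsilon>"
      proof
        fix z assume "z \<in> cball x0 r"
        then show "z \<in> cball x \<epsilon>"
          using dist_triangle[of x z x0] r d by (simp add: d_def)
      qed
      then have "(\<integral>y. indicator (cball x0 r) y * ?f y \<partial>lborel) \<le> (\<integral>y. indicator (cball x \<epsilon>) y * ?f y \<partial>lborel)"
        by (intro integral_mono' integrable_powr[OF csub]) (auto simp: indicator_def)
      then show "(\<integral>y. indicator (cball x0 r) y * ?f y \<partial>lborel) \<le> \<epsilon>\<^sup>2 * \<delta>" using J by linarith
    qed
    show ?thesis
    proof (cases "U powr (p - 1) * (d / 2)\<^sup>2 \<le> \<epsilon>\<^sup>2 / 2")
      case True
      from bound[OF _ _ this] d show ?thesis by (simp add: \<Phi>0 power_divide field_simps)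
    next
      case False
      \<comment> \<open>the largest radius that \<open>bound\<close> allows at height \<open>U\<close>\<close>
      define r where "r = sqrt (\<epsilon>\<^sup>2 / 2 * U powr (1 - p))"
      have r2: "r\<^sup>2 = \<epsilon>\<^sup>2 / 2 * U powr (1 - p)" by (simp add: r_def)
      have UU: "U powr (p - 1) * U powr (1 - p) = 1" using U by (simp add: powr_add[symmetric])
      have rU: "U powr (p - 1) * r\<^sup>2 = \<epsilon>\<^sup>2 / 2" unfolding r2 using UU by (simp add: algebra_simps)
      then have "U powr (p - 1) * r\<^sup>2 < U powr (p - 1) * (d / 2)\<^sup>2" using False by linarith
      then have "r\<^sup>2 < (d / 2)\<^sup>2" by (rule mult_left_less_imp_less) simp
      then have rd: "r < d / 2" using d by (intro power2_less_imp_less[of r "d / 2"]) simp_all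
      have r0: "0 < r" unfolding r_def using U \<epsilon> by simp
      have "U powr p * r\<^sup>2 = U * (\<epsilon>\<^sup>2 / 2)"
      proof -
        have "U powr p = U * U powr (p - 1)" using U powr_add[of U 1 "p - 1"] by simp
        then have "U powr p * r\<^sup>2 = U * (U powr (p - 1) * r\<^sup>2)" by (simp only: mult.assoc)
        then show ?thesis unfolding rU .
      qed
      \<comment> \<open>At this radius the bound is linear in \<open>U\<close>. Smallness of
        \<open>\<delta>\<close> gives \<open>U \<le> 1\<close>, and with
        \<open>d \<le> \<epsilon>\<close> this contradicts the case assumption.\<close>
      then have "U * (\<epsilon>\<^sup>2 / 2) \<le> C * (\<epsilon>\<^sup>2 * \<delta>)" using bound[OF r0] rd rU by simp
      then have "\<epsilon>\<^sup>2 * U \<le> \<epsilon>\<^sup>2 * (2 * C * \<delta>)" by (simp add: algebra_simps)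
      then have "U \<le> 2 * C * \<delta>" using \<epsilon> by simp
      also have "\<dots> \<le> 1" using \<delta> by (simp add: C_def)
      finally have "U powr (p - 1) \<le> 1" using U p by (intro powr_le1) auto
      then have "U powr (p - 1) * (d / 2)\<^sup>2 \<le> 1 * (\<epsilon> / 2)\<^sup>2"
        using d by (intro mult_mono power_mono) auto
      also have "\<dots> \<le> \<epsilon>\<^sup>2 / 2" by (simp add: power_divide)
      finally show ?thesis using False by simp
    qed
  qed
  with \<Phi>x have "\<epsilon>\<^sup>2 * ?f x \<le> \<epsilon>\<^sup>2 * (4 * C * \<delta>)"
    by (simp add: mult.left_commute)
  then have "?f x \<le> 4 * C * \<delta>"
    by (rule mult_left_le_imp_le) (use \<epsilon> in simp)
  then show ?thesis by (simp add: C_def)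
qed

end

section \<open>Uniform convergence on compact sets\<close>

text \<open>The nonnegative integral makes the bound a genuine finiteness condition; a real-valued
  Lebesgue integral is \<open>0\<close> by default when the integrand is not integrable. Local
  uniformity is expressed through compact subsets.\<close>

theorem proposition4p1:
  fixes \<Omega> :: "(real ^ 2) set" and \<beta> p H :: real
    and \<epsilon> :: "nat \<Rightarrow> real" and v :: "nat \<Rightarrow> real ^ 2 \<Rightarrow> real"
  assumes "0 < \<beta>" and "\<beta> < 1" and "bounded_C2_holder_domain \<beta> \<Omega>"
    and "1 < p"
    and "\<And>n. 0 < \<epsilon> n" and "decseq \<epsilon>" and "\<epsilon> \<longlonglongrightarrow> 0"
    and "\<And>n. classical_solution p (\<epsilon> n) \<Omega> (v n)"
    and "\<And>n x. x \<in> \<Omega> \<Longrightarrow> 0 \<le> v n x"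
    and "0 < H"
    and "\<And>n. (\<integral>\<^sup>+x\<in>\<Omega>. ennreal (1 / (\<epsilon> n)\<^sup>2 * [v n x - 1]\<^sub>+ powr (p - 1)) \<partial>lborel) \<le> ennreal H"
  shows "\<forall>K. compact K \<and> K \<subseteq> \<Omega> \<longrightarrow>
    uniform_limit K (\<lambda>n x. [v n x - 1]\<^sub>+) (\<lambda>x. 0) sequentially"
proof (intro allI impI)
  fix K assume K: "compact K \<and> K \<subseteq> \<Omega>"
  have \<Omega>: "open \<Omega>" using assms(3) by (simp add: bounded_C2_holder_domain_def)
  \<comment> \<open>The Lebesgue number of the cover of \<open>K\<close> by \<open>\<Omega>\<close>
    alone is one radius that serves all points of \<open>K\<close>.\<close>
  obtain \<rho> where \<rho>: "0 < \<rho>" "\<And>x. x \<in> K \<Longrightarrow> ball x \<rho> \<subseteq> \<Omega>"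
  proof -
    have "compact K" "K \<subseteq> \<Union>{\<Omega>}" "\<And>c. c \<in> {\<Omega>} \<Longrightarrow> open c" using K \<Omega> by auto
    from Heine_Borel_lemma[OF this] obtain e where "0 < e" "\<And>x. x \<in> K \<Longrightarrow> \<exists>G\<in>{\<Omega>}. ball x e \<subseteq> G"
      by metis
    then show thesis using that by auto
  qed
  define c where "c = bump_mass TYPE(real^2)"
  have c: "0 < c" unfolding c_def by (rule bump_mass_pos)
  define M where "M = c * (1 + H powr (1 / (p - 1)))"
  \<comment> \<open>This is the bound of \<open>powr_mass_bound\<close> divided by the logarithm and
    by \<open>(\<epsilon> n)\<^sup>2\<close>; it does not depend on the point of
    \<open>K\<close>.\<close>
  define \<delta> where "\<delta> n = M / (9/16 * ln (\<rho> / (8 * \<epsilon> n)))" for n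
  have ln_top: "filterlim (\<lambda>n. 9/16 * ln (\<rho> / (8 * \<epsilon> n))) at_top sequentially"
  proof -
    \<comment> \<open>Positivity of \<open>\<epsilon> n\<close> gives convergence to
      \<open>0\<close> from the right, under which the inverse tends to infinity.\<close>
    have "filterlim (\<lambda>n. 8 * \<epsilon> n) (at_right 0) sequentially"
      unfolding filterlim_at
      using assms(5) tendsto_mult_right_zero[OF assms(7), of 8] less_imp_neq[OF assms(5)]
      by (auto intro!: always_eventually)
    then have "filterlim (\<lambda>n. \<rho> / (8 * \<epsilon> n)) at_top sequentially"
      unfolding divide_inverse
      by (intro filterlim_tendsto_pos_mult_at_top[OF tendsto_const \<rho>(1)]
          filterlim_compose[OF filterlim_inverse_at_top_right])
    then show ?thesis
      by (intro filterlim_tendsto_pos_mult_at_top[OF tendsto_const] filterlim_compose[OF ln_at_top]) auto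
  qed
  have \<delta>_lim: "\<delta> \<longlonglongrightarrow> 0" unfolding \<delta>_def
    by (rule real_tendsto_divide_at_top[OF tendsto_const ln_top])
  show "uniform_limit K (\<lambda>n x. [v n x - 1]\<^sub>+) (\<lambda>x. 0) sequentially"
  proof (rule uniform_limitI)
    fix e :: real assume e: "0 < e"
    \<comment> \<open>The first sequence is the smallness required by
      \<open>pointwise_bound\<close>, the second the bound that it returns. The latter is compared
      with \<open>e powr p\<close> because it concerns the \<open>p\<close>-th power.\<close>
    have "(\<lambda>n. 4 * 4 powr p / c * \<delta> n) \<longlonglongrightarrow> 0" "(\<lambda>n. 8 * 4 powr p / c * \<delta> n) \<longlonglongrightarrow> 0"
      by (rule tendsto_mult_right_zero[OF \<delta>_lim])+
    from order_tendstoD(2)[OF this(1), of 1] order_tendstoD(2)[OF this(2), of "e powr p"]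
    have "\<forall>\<^sub>F n in sequentially. 4 * 4 powr p / c * \<delta> n < 1"
      "\<forall>\<^sub>F n in sequentially. 8 * 4 powr p / c * \<delta> n < e powr p"
      using e by simp_all
    moreover have "\<forall>\<^sub>F n in sequentially. \<epsilon> n < \<rho> / 8"
      using order_tendstoD(2)[OF assms(7), of "\<rho> / 8"] \<rho>(1) by simp
    ultimately show "\<forall>\<^sub>F n in sequentially. \<forall>x\<in>K. dist [v n x - 1]\<^sub>+ 0 < e"
    proof eventually_elim
      case (elim n)
      show ?case
      proof
        fix x assume x: "x \<in> K"
        have ln0: "0 < ln (\<rho> / (8 * \<epsilon> n))" using elim(3) assms(5)[of n] \<rho>(1) by simp
        have "(\<integral>y. indicator (cball x (\<epsilon> n)) y * [v n y - 1]\<^sub>+ powr p \<partial>lborel) * (9/16 * ln (\<rho> / (8 * \<epsilon> n)))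
          \<le> (\<epsilon> n)\<^sup>2 * M"
          unfolding M_def c_def
          by (rule powr_mass_bound[OF \<Omega> assms(4,5,8,9) \<rho>(2)[OF x] _ assms(10,11)]) (use elim(3) in auto)
        then have J: "(\<integral>y. indicator (cball x (\<epsilon> n)) y * [v n y - 1]\<^sub>+ powr p \<partial>lborel) \<le> (\<epsilon> n)\<^sup>2 * \<delta> n"
          using ln0 by (simp add: \<delta>_def pos_le_divide_eq)
        have sub: "ball x (2 * \<epsilon> n) \<subseteq> \<Omega>" using \<rho>(2)[OF x] elim(3) assms(5)[of n] by (auto simp: subset_iff)
        have "[v n x - 1]\<^sub>+ powr p \<le> 8 * 4 powr p / c * \<delta> n" unfolding c_def
          by (rule pointwise_bound[OF \<Omega> assms(4,5,8,9) sub J]) (use elim(1) in \<open>auto simp: c_def\<close>)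
        also have "\<dots> < e powr p" by (rule elim(2))
        \<comment> \<open>Monotonicity of the power with positive exponent \<open>p\<close>,
          contraposed.\<close>
        finally have "[v n x - 1]\<^sub>+ < e"
          using assms(4) e by (metis less_eq_real_def linorder_not_less powr_mono2 order.strict_trans zero_less_one)
        then show "dist [v n x - 1]\<^sub>+ 0 < e" by (simp add: pos_part_bounds dist_real_def)
      qed
    qed
  qed
qed

end
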